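(* $\mathrm{two}^+\geq 2$; that is, there is no online coloring algorithm for 2-count interval graphs with competitive ratio less than $2$ in the setting where the interval representation is known but the interval lengths are not known in advance.
   Context: A 2-count interval graph is a graph having an interval representation (an assignment of closed real intervals to vertices such that two vertices are adjacent iff their intervals intersect) in which at most two distinct interval lengths occur. In the setting $\mathrm{two}^+$, closed intervals (with at most two distinct lengths overall, not announced in advance) are presented one at a time (the algorithm sees the intervals themselves), and the algorithm must irrevocably assign each interval a color different from the colors of previously presented intervals intersecting it. For an online algorithm $A$, $\chi_A(G)$ denotes the maximum number of colors $A$ uses on $G$ over all presentations; $A$ is $\rho$-competitive if there is $b\in\mathbb{R}$ with $\chi_A(G)\le\rho\chi(G)+b$ for all graphs $G$ in the class; the competitive ratio of $A$ is the infimum of such $\rho$, and $\mathrm{two}^+$ is the infimum of the competitive ratios over all online algorithms in this setting. *)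

theory Defs
  imports Complex_Main "HOL-Library.Extended_Real"
begin

text \<open>Finite simple graphs are given by a vertex set and a set of two-element edges. Every finite
  graph has an isomorphic copy on natural numbers, so vertices are taken to be of type \<^typ>\<open>nat\<close>.\<close>

record graph =
  verts :: "nat set"
  edges :: "nat set set"

definition simple_graph :: "graph \<Rightarrow> bool" where
  "simple_graph G \<longleftrightarrow> finite (verts G) \<and> edges G \<subseteq> {e. e \<subseteq> verts G \<and> card e = 2}"

definition proper_coloring :: "graph \<Rightarrow> (nat \<Rightarrow> nat) \<Rightarrow> bool" where
  "proper_coloring G c \<longleftrightarrow>
     (\<forall>u\<in>verts G. \<forall>v\<in>verts G. {u, v} \<in> edges G \<longrightarrow> c u \<noteq> c v)"

definition chromatic_number :: "graph \<Rightarrow> nat" where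
  "chromatic_number G = (LEAST k. \<exists>c. proper_coloring G c \<and> card (c ` verts G) = k)"

text \<open>A pair \<open>(l, r)\<close> with \<open>l \<le> r\<close> stands for the closed interval from \<open>l\<close> to \<open>r\<close>.\<close>

type_synonym interval = "real \<times> real"

definition is_interval :: "interval \<Rightarrow> bool" where
  "is_interval I \<longleftrightarrow> fst I \<le> snd I"

definition ival_length :: "interval \<Rightarrow> real" where
  "ival_length I = snd I - fst I"

definition intersecting :: "interval \<Rightarrow> interval \<Rightarrow> bool" where
  "intersecting I J \<longleftrightarrow> {fst I..snd I} \<inter> {fst J..snd J} \<noteq> {}"

definition interval_rep :: "graph \<Rightarrow> (nat \<Rightarrow> interval) \<Rightarrow> bool" where
  "interval_rep G f \<longleftrightarrow>
     (\<forall>v\<in>verts G. is_interval (f v)) \<and>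
     (\<forall>u\<in>verts G. \<forall>v\<in>verts G. u \<noteq> v \<longrightarrow> ({u, v} \<in> edges G \<longleftrightarrow> intersecting (f u) (f v)))"

definition two_count_rep :: "graph \<Rightarrow> (nat \<Rightarrow> interval) \<Rightarrow> bool" where
  "two_count_rep G f \<longleftrightarrow> interval_rep G f \<and> card (ival_length ` f ` verts G) \<le> 2"

definition two_count_graph :: "graph \<Rightarrow> bool" where
  "two_count_graph G \<longleftrightarrow> simple_graph G \<and> (\<exists>f. two_count_rep G f)"

text \<open>A list of intervals presents \<open>G\<close> if it lists the intervals of some representation of \<open>G\<close>
  with at most two lengths, each vertex contributing exactly one entry. Distinct vertices may have
  equal intervals.\<close>

definition presents :: "interval list \<Rightarrow> graph \<Rightarrow> bool" where
  "presents \<sigma> G \<longleftrightarrow>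
     (\<exists>f vs. two_count_rep G f \<and> distinct vs \<and> set vs = verts G \<and> \<sigma> = map f vs)"

text \<open>A (deterministic) algorithm maps the intervals presented earlier and the current interval to
  the color of the current interval. The colors assigned earlier need not be passed, since they are
  determined by the earlier intervals.\<close>

type_synonym algorithm = "interval list \<Rightarrow> interval \<Rightarrow> nat"

definition assigned_color :: "algorithm \<Rightarrow> interval list \<Rightarrow> nat \<Rightarrow> nat" where
  "assigned_color A \<sigma> i = A (take i \<sigma>) (\<sigma> ! i)"

definition num_colors :: "algorithm \<Rightarrow> interval list \<Rightarrow> nat" where
  "num_colors A \<sigma> = card (assigned_color A \<sigma> ` {..<length \<sigma>})"

definition online_coloring_algorithm :: "algorithm \<Rightarrow> bool" where
  "online_coloring_algorithm A \<longleftrightarrow>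
     (\<forall>G \<sigma>. two_count_graph G \<and> presents \<sigma> G \<longrightarrow>
        (\<forall>j<length \<sigma>. \<forall>i<j. intersecting (\<sigma> ! i) (\<sigma> ! j) \<longrightarrow>
           assigned_color A \<sigma> i \<noteq> assigned_color A \<sigma> j))"

definition online_chromatic :: "algorithm \<Rightarrow> graph \<Rightarrow> nat" where
  "online_chromatic A G = Max {num_colors A \<sigma> | \<sigma>. presents \<sigma> G}"

text \<open>The maximum above is taken over a finite nonempty set for every graph in the class.\<close>

lemma presents_length: "presents \<sigma> G \<Longrightarrow> length \<sigma> = card (verts G)"
  by (auto simp: presents_def dest: distinct_card)

lemma online_chromatic_finite: "finite {num_colors A \<sigma> | \<sigma>. presents \<sigma> G}"
proof (rule finite_subset)
  have "num_colors A \<sigma> \<le> length \<sigma>" for \<sigma>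
    unfolding num_colors_def using card_image_le[of "{..<length \<sigma>}"] by auto
  then have "num_colors A \<sigma> \<le> card (verts G)" if "presents \<sigma> G" for \<sigma>
    using presents_length[OF that] by metis
  then show "{num_colors A \<sigma> | \<sigma>. presents \<sigma> G} \<subseteq> {..card (verts G)}"
    by auto
qed simp

lemma online_chromatic_nonempty:
  assumes "two_count_graph G"
  shows "{num_colors A \<sigma> | \<sigma>. presents \<sigma> G} \<noteq> {}"
proof -
  obtain f where "two_count_rep G f" using assms by (auto simp: two_count_graph_def)
  moreover obtain vs where "set vs = verts G" "distinct vs"
    using assms finite_distinct_list[of "verts G"]
    by (auto simp: two_count_graph_def simple_graph_def)
  ultimately show ?thesis unfolding presents_def by blast
qed

definition competitive :: "algorithm \<Rightarrow> real \<Rightarrow> bool" where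
  "competitive A \<rho> \<longleftrightarrow>
     (\<exists>b::real. \<forall>G. two_count_graph G \<longrightarrow>
        real (online_chromatic A G) \<le> \<rho> * real (chromatic_number G) + b)"

text \<open>Infima are taken in the extended reals, so that an algorithm that is not competitive for
  any factor has ratio \<open>\<infinity>\<close>.\<close>

definition competitive_ratio :: "algorithm \<Rightarrow> ereal" where
  "competitive_ratio A = Inf {ereal \<rho> | \<rho>. competitive A \<rho>}"

definition two_plus :: ereal where
  "two_plus = Inf {competitive_ratio A | A. online_coloring_algorithm A}"

lemma online_coloring_algorithm_exists: "online_coloring_algorithm (\<lambda>\<sigma> I. length \<sigma>)"
  by (auto simp: online_coloring_algorithm_def assigned_color_def)

end

theory Submission
  imports Defs
begin

text \<open>The adversary keeps the clique number at most \<open>4 * n\<close> and forces \<open>8 * n\<close> colors.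

  With unit intervals and clique number \<open>2 * n\<close> it forces \<open>3 * n\<close> colors: after \<open>n\<close> copies of one
  interval, with color set \<open>C\<close>, it presents a clique of \<open>2 * n\<close> intervals whose left endpoints are
  found by bisection, so that the \<open>q \<ge> n\<close> intervals with colors outside \<open>C\<close> lie to the left of all
  the others; then \<open>2 * n - q\<close> copies of an interval meeting exactly these \<open>q\<close> intervals and the
  first \<open>n\<close> get further colors.

  Such gadgets are nested in clusters, four clusters of one level forming a cluster of the next.
  Either a cluster has more colors than one of its four parts, which cannot
  happen on every level, or the four parts have the same set of at least \<open>3 * n\<close> colors. In the
  latter case the second length is chosen on the scale of that cluster. Every long interval contains
  one of the four parts, hence avoids its colors. Two disjoint groups of \<open>2 * n\<close> equal long intervals
  get color sets \<open>D\<close> and \<open>E\<close>. If they share at most \<open>n\<close> colors, a third group meeting both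
  brings the number of long colors to \<open>5 * n\<close>; otherwise a path of two more groups between them
  does.\<close>

section \<open>Clique number and chromatic number\<close>

abbreviation ival_set :: "interval \<Rightarrow> real set" where
  "ival_set I \<equiv> {fst I..snd I}"

text \<open>Intervals are pairwise intersecting exactly when they share a point (Helly), so the
  maximum of \<open>load\<close> over all points is the clique number.\<close>

definition load :: "interval list \<Rightarrow> real \<Rightarrow> nat" where
  "load \<sigma> x = length (filter (\<lambda>I. x \<in> ival_set I) \<sigma>)"

lemma load_Nil [simp]: "load [] x = 0"
  by (simp add: load_def)

lemma load_append [simp]: "load (\<sigma> @ \<tau>) x = load \<sigma> x + load \<tau> x"
  by (simp add: load_def)

lemma load_replicate [simp]: "load (replicate m I) x = (if x \<in> ival_set I then m else 0)"
  by (simp add: load_def)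

lemma load_eq_0: "(\<And>I. I \<in> set \<sigma> \<Longrightarrow> x \<notin> ival_set I) \<Longrightarrow> load \<sigma> x = 0"
  by (auto simp: load_def filter_empty_conv)

lemma load_le_filter:
  assumes "\<And>I. I \<in> set \<sigma> \<Longrightarrow> x \<in> ival_set I \<Longrightarrow> P I"
  shows "load \<sigma> x \<le> length (filter P \<sigma>)"
proof -
  have "filter (\<lambda>I. x \<in> ival_set I) \<sigma> = filter (\<lambda>I. x \<in> ival_set I) (filter P \<sigma>)"
    using assms by (auto intro: filter_cong)
  then show ?thesis unfolding load_def by (metis length_filter_le)
qed

lemma intersecting_commute: "intersecting I J \<longleftrightarrow> intersecting J I"
  by (auto simp: intersecting_def)

lemma intersecting_iff:
  assumes "is_interval I" "is_interval J"
  shows "intersecting I J \<longleftrightarrow> fst I \<le> snd J \<and> fst J \<le> snd I"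
  using assms by (auto simp: intersecting_def is_interval_def)

text \<open>Greedy coloring in the order of left endpoints.\<close>

lemma interval_coloring:
  assumes "finite V" and "\<And>v. v \<in> V \<Longrightarrow> is_interval (f v)"
    and "\<And>x. card {v \<in> V. x \<in> ival_set (f v)} \<le> m"
  shows "\<exists>c. c ` V \<subseteq> {..<m::nat} \<and>
    (\<forall>u\<in>V. \<forall>v\<in>V. u \<noteq> v \<longrightarrow> intersecting (f u) (f v) \<longrightarrow> c u \<noteq> c v)"
  using assms
proof (induction "card V" arbitrary: V)
  case 0
  then show ?case by simp
next
  case (Suc k)
  have "V \<noteq> {}" using Suc.hyps(2) by auto
  then have "Max ((\<lambda>u. fst (f u)) ` V) \<in> (\<lambda>u. fst (f u)) ` V"
    using Suc.prems(1) by (intro Max_in) auto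
  then obtain v where "v \<in> V" "Max ((\<lambda>u. fst (f u)) ` V) = fst (f v)" by auto
  then have v: "v \<in> V" "\<And>u. u \<in> V \<Longrightarrow> fst (f u) \<le> fst (f v)"
    using Suc.prems(1) Max_ge[of "(\<lambda>u. fst (f u)) ` V"] by auto
  let ?V = "V - {v}"
  have "card {w \<in> ?V. x \<in> ival_set (f w)} \<le> m" for x
    using card_mono[of "{v \<in> V. x \<in> ival_set (f v)}" "{w \<in> ?V. x \<in> ival_set (f w)}"]
      Suc.prems(1) Suc.prems(3)[of x] by fastforce
  moreover have "k = card ?V" using Suc.hyps(2) v(1) Suc.prems(1) by simp
  ultimately obtain c where c: "c ` ?V \<subseteq> {..<m}"
    "\<forall>u\<in>?V. \<forall>w\<in>?V. u \<noteq> w \<longrightarrow> intersecting (f u) (f w) \<longrightarrow> c u \<noteq> c w"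
    using Suc.hyps(1)[of ?V] Suc.prems(1,2) by auto
  let ?N = "{w \<in> ?V. intersecting (f w) (f v)}"
  \<comment> \<open>\<open>v\<close> has the largest left endpoint, so every interval meeting it
    contains that endpoint. This leaves \<open>v\<close> fewer than \<open>m\<close> neighbours, and
    a color below \<open>m\<close> is free for it.\<close>
  have "insert v ?N \<subseteq> {w \<in> V. fst (f v) \<in> ival_set (f w)}"
  proof
    fix w assume "w \<in> insert v ?N"
    then show "w \<in> {w \<in> V. fst (f v) \<in> ival_set (f w)}"
      using v Suc.prems(2)[of w] Suc.prems(2)[of v] intersecting_iff[of "f w" "f v"]
      by (auto simp: is_interval_def)
  qed
  then have "card (insert v ?N) \<le> m"
    using card_mono[of "{w \<in> V. fst (f v) \<in> ival_set (f w)}" "insert v ?N"]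
      Suc.prems(1) Suc.prems(3)[of "fst (f v)"] by auto
  then have "card ?N < m" using Suc.prems(1) by simp
  then have "card (c ` ?N) < m" using card_image_le[of ?N c] Suc.prems(1) by simp
  then have "\<not> {..<m} \<subseteq> c ` ?N"
    using card_mono[of "c ` ?N" "{..<m}"] Suc.prems(1) by auto
  then obtain b where b: "b < m" "b \<notin> c ` ?N" by auto
  have "(c(v := b)) ` V \<subseteq> {..<m}" using b c(1) by auto
  moreover have "\<forall>u\<in>V. \<forall>w\<in>V. u \<noteq> w \<longrightarrow> intersecting (f u) (f w) \<longrightarrow>
      (c(v := b)) u \<noteq> (c(v := b)) w"
  proof (intro ballI impI)
    fix u w assume uw: "u \<in> V" "w \<in> V" "u \<noteq> w" "intersecting (f u) (f w)"
    have nb: "c y \<noteq> b" if "y \<in> V" "y \<noteq> v" "intersecting (f y) (f v)" for y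
      using b(2) that by blast
    show "(c(v := b)) u \<noteq> (c(v := b)) w"
      using uw nb[of u] nb[of w] c(2) intersecting_commute[of "f u" "f w"] by auto
  qed
  ultimately show ?case by blast
qed

text \<open>Vertices are positions in the list, so repeated copies of one interval become distinct,
  adjacent vertices.\<close>

definition graph_of :: "interval list \<Rightarrow> graph" where
  "graph_of \<sigma> = \<lparr>verts = {..<length \<sigma>},
     edges = {{i, j} |i j. i < length \<sigma> \<and> j < length \<sigma> \<and> i \<noteq> j \<and> intersecting (\<sigma> ! i) (\<sigma> ! j)}\<rparr>"

definition two_len :: "interval list \<Rightarrow> bool" where
  "two_len \<sigma> \<longleftrightarrow> (\<forall>I\<in>set \<sigma>. is_interval I) \<and> card (ival_length ` set \<sigma>) \<le> 2"

lemma two_count_rep_graph_of: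
  assumes "two_len \<sigma>"
  shows "two_count_rep (graph_of \<sigma>) ((!) \<sigma>)"
proof -
  have "(!) \<sigma> ` {..<length \<sigma>} = set \<sigma>"
    by (force simp: in_set_conv_nth)
  then show ?thesis
    using assms unfolding two_count_rep_def interval_rep_def graph_of_def two_len_def
    by (auto simp: doubleton_eq_iff intersecting_commute)
qed

lemma two_count_graph_of:
  assumes "two_len \<sigma>"
  shows "two_count_graph (graph_of \<sigma>)"
proof -
  have "simple_graph (graph_of \<sigma>)"
    by (auto simp: simple_graph_def graph_of_def)
  then show ?thesis
    using two_count_rep_graph_of[OF assms] by (auto simp: two_count_graph_def)
qed

lemma presents_graph_of:
  assumes "two_len \<sigma>"
  shows "presents \<sigma> (graph_of \<sigma>)"
  unfolding presents_def
proof (intro exI conjI)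
  show "two_count_rep (graph_of \<sigma>) ((!) \<sigma>)" by (rule two_count_rep_graph_of[OF assms])
  show "distinct [0..<length \<sigma>]" by simp
  show "set [0..<length \<sigma>] = verts (graph_of \<sigma>)" by (auto simp: graph_of_def)
  show "\<sigma> = map ((!) \<sigma>) [0..<length \<sigma>]" by (simp add: map_nth)
qed

lemma chromatic_number_graph_of:
  assumes "two_len \<sigma>" and load: "\<And>x. load \<sigma> x \<le> m"
  shows "chromatic_number (graph_of \<sigma>) \<le> m"
proof -
  have "card {v \<in> {..<length \<sigma>}. x \<in> ival_set (\<sigma> ! v)} \<le> m" for x
    using load[of x] by (simp add: load_def length_filter_conv_card)
  then obtain c where c: "c ` {..<length \<sigma>} \<subseteq> {..<m}"
    "\<forall>u\<in>{..<length \<sigma>}. \<forall>v\<in>{..<length \<sigma>}. u \<noteq> v \<longrightarrow> intersecting (\<sigma> ! u) (\<sigma> ! v) \<longrightarrow> c u \<noteq> c v"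
    using interval_coloring[of "{..<length \<sigma>}" "(!) \<sigma>" m] assms(1)
    by (auto simp: two_len_def)
  have "c u \<noteq> c v" if "{u, v} \<in> edges (graph_of \<sigma>)" for u v
  proof -
    have "u < length \<sigma> \<and> v < length \<sigma> \<and> u \<noteq> v \<and> intersecting (\<sigma> ! u) (\<sigma> ! v)"
      using that by (auto simp: graph_of_def doubleton_eq_iff intersecting_commute)
    then show ?thesis using c(2) by simp
  qed
  then have "proper_coloring (graph_of \<sigma>) c" by (simp add: proper_coloring_def)
  then have "chromatic_number (graph_of \<sigma>) \<le> card (c ` verts (graph_of \<sigma>))"
    unfolding chromatic_number_def by (intro Least_le) auto
  also have "\<dots> \<le> card {..<m}"
    using c(1) by (intro card_mono) (auto simp: graph_of_def)
  finally show ?thesis by simp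
qed

section \<open>Runs of an algorithm\<close>

text \<open>The first list is the history, on which the colors depend. Each color is kept with its
  interval so that colors can later be selected by the position of their intervals.\<close>

fun run :: "algorithm \<Rightarrow> interval list \<Rightarrow> interval list \<Rightarrow> (interval \<times> nat) set" where
  "run A \<sigma> [] = {}"
| "run A \<sigma> (I # \<tau>) = insert (I, A \<sigma> I) (run A (\<sigma> @ [I]) \<tau>)"

abbreviation cols :: "algorithm \<Rightarrow> interval list \<Rightarrow> interval list \<Rightarrow> nat set" where
  "cols A \<sigma> \<tau> \<equiv> snd ` run A \<sigma> \<tau>"

lemma run_append [simp]: "run A \<sigma> (\<tau> @ \<tau>') = run A \<sigma> \<tau> \<union> run A (\<sigma> @ \<tau>) \<tau>'"
  by (induction \<tau> arbitrary: \<sigma>) auto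

lemma finite_run [simp]: "finite (run A \<sigma> \<tau>)"
  by (induction \<tau> arbitrary: \<sigma>) auto

lemma fst_run: "fst ` run A \<sigma> \<tau> = set \<tau>"
  by (induction \<tau> arbitrary: \<sigma>) auto

lemma in_run: "(I, c) \<in> run A \<sigma> \<tau> \<Longrightarrow> I \<in> set \<tau>"
  by (metis fst_conv fst_run image_eqI)

lemma run_conv_nth:
  "run A \<sigma> \<tau> = (\<lambda>i. (\<tau> ! i, A (\<sigma> @ take i \<tau>) (\<tau> ! i))) ` {..<length \<tau>}"
  by (induction \<tau> arbitrary: \<sigma>) (simp_all add: lessThan_Suc_eq_insert_0 image_image)

lemma num_colors_conv_cols: "num_colors A \<sigma> = card (cols A [] \<sigma>)"
  by (simp add: num_colors_def assigned_color_def[abs_def] run_conv_nth image_image)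

text \<open>One length is fixed to 1 and \<open>l\<close> is left open: the adversary starts with
  unit intervals and settles the second length only later.\<close>

lemma two_lenI:
  assumes "l \<ge> 0" and "\<And>I. I \<in> set \<sigma> \<Longrightarrow> ival_length I = 1 \<or> ival_length I = l"
  shows "two_len \<sigma>"
proof -
  have "card (ival_length ` set \<sigma>) \<le> card {1, l}"
    using assms(2) by (intro card_mono) auto
  also have "\<dots> \<le> 2" by (simp add: card_insert_if)
  finally show ?thesis
    using assms by (force simp: two_len_def is_interval_def ival_length_def)
qed

section \<open>Color sets of cliques and of repeated intervals\<close>

context
  fixes A :: algorithm
  assumes alg: "online_coloring_algorithm A"
begin

text \<open>Properness is promised only for presentations of 2-count graphs; here it is applied to
  the graph of the whole list \<open>\<sigma> @ \<tau>\<close>.\<close>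

lemma run_disjoint:
  assumes "two_len (\<sigma> @ \<tau>)" "(I, c) \<in> run A [] \<sigma>" "(J, d) \<in> run A \<sigma> \<tau>" "intersecting I J"
  shows "c \<noteq> d"
proof -
  obtain i where i: "i < length \<sigma>" "I = \<sigma> ! i" "c = A (take i \<sigma>) (\<sigma> ! i)"
    using assms(2) by (auto simp: run_conv_nth)
  obtain j where j: "j < length \<tau>" "J = \<tau> ! j" "d = A (\<sigma> @ take j \<tau>) (\<tau> ! j)"
    using assms(3) by (auto simp: run_conv_nth)
  let ?\<rho> = "\<sigma> @ \<tau>"
  have "assigned_color A ?\<rho> i \<noteq> assigned_color A ?\<rho> (length \<sigma> + j)"
    using alg two_count_graph_of[OF assms(1)] presents_graph_of[OF assms(1)] i j assms(4)
    unfolding online_coloring_algorithm_def by (auto simp: nth_append)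
  then show ?thesis using i j by (simp add: assigned_color_def nth_append)
qed

text \<open>Intervals through a common point pairwise intersect, so no color is repeated. The
  predicate \<open>P\<close> lets the two sides of a separation point be counted separately.\<close>

lemma card_cols_clique:
  assumes "two_len (\<sigma> @ \<tau>)" "\<And>I. I \<in> set \<tau> \<Longrightarrow> x \<in> ival_set I"
  shows "card (snd ` {e \<in> run A \<sigma> \<tau>. P (fst e)}) = length (filter P \<tau>)"
  using assms
proof (induction \<tau> arbitrary: \<sigma>)
  case Nil
  then show ?case by simp
next
  case (Cons I \<tau>)
  let ?R = "{e \<in> run A (\<sigma> @ [I]) \<tau>. P (fst e)}"
  have IH: "card (snd ` ?R) = length (filter P \<tau>)"
    using Cons.IH[of "\<sigma> @ [I]"] Cons.prems by simp
  have "A \<sigma> I \<notin> snd ` ?R"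
  proof
    assume "A \<sigma> I \<in> snd ` ?R"
    then obtain J where J: "(J, A \<sigma> I) \<in> run A (\<sigma> @ [I]) \<tau>" by auto
    have "intersecting I J"
      using Cons.prems(2)[of I] Cons.prems(2)[of J] in_run[OF J] by (auto simp: intersecting_def)
    then show False
      using run_disjoint[of "\<sigma> @ [I]" \<tau> I "A \<sigma> I", OF _ _ J] Cons.prems(1) by simp
  qed
  moreover have "{e \<in> run A \<sigma> (I # \<tau>). P (fst e)} = (if P I then insert (I, A \<sigma> I) ?R else ?R)"
    by auto
  ultimately show ?case using IH by simp
qed

lemma card_cols_replicate:
  assumes "two_len (\<sigma> @ replicate m I)" "is_interval I"
  shows "card (cols A \<sigma> (replicate m I)) = m"
  using card_cols_clique[OF assms(1), of "fst I" "\<lambda>_. True"] assms(2)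
  by (auto simp: is_interval_def)

text \<open>\<open>R\<close> may be a part of the history only, since a new group meets some of the
  earlier intervals and misses others.\<close>

lemma cols_replicate_disjoint:
  assumes "two_len (\<sigma> @ replicate m I)"
    and "R \<subseteq> run A [] \<sigma>" "\<And>J. J \<in> fst ` R \<Longrightarrow> intersecting J I"
  shows "snd ` R \<inter> cols A \<sigma> (replicate m I) = {}"
proof -
  have False if J: "(J, c) \<in> R" and K: "(K, c) \<in> run A \<sigma> (replicate m I)" for J K c
  proof -
    have "J \<in> fst ` R" using J by force
    moreover have "K = I" using in_run[OF K] by simp
    ultimately show False
      using run_disjoint[OF assms(1) subsetD[OF assms(2) J] K] assms(3) by blast
  qed
  then show ?thesis by fastforce
qed

end

section \<open>Unit intervals\<close>

abbreviation unit_len :: "interval list \<Rightarrow> bool" where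
  "unit_len \<sigma> \<equiv> \<forall>I\<in>set \<sigma>. snd I = fst I + 1"

abbreviation located :: "interval list \<Rightarrow> real \<Rightarrow> real \<Rightarrow> bool" where
  "located \<sigma> a b \<equiv> \<forall>I\<in>set \<sigma>. a \<le> fst I \<and> snd I \<le> b"

lemma two_len_unit: "unit_len \<sigma> \<Longrightarrow> two_len \<sigma>"
  by (rule two_lenI[of 1]) (auto simp: ival_length_def)

lemma load_located: "located \<sigma> a b \<Longrightarrow> x < a \<or> b < x \<Longrightarrow> load \<sigma> x = 0"
  by (rule load_eq_0) force

text \<open>Bisection: the next interval starts at the midpoint \<open>p\<close>. If its color lies
  in \<open>C\<close>, the search goes on to the left of \<open>p\<close>, otherwise to the right,
  so \<open>t\<close> ends up on the correct side of every point tried.\<close>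

lemma separation:
  assumes "lo < hi"
  shows "\<exists>\<tau> t. length \<tau> = N \<and> lo < t \<and> t < hi \<and> unit_len \<tau> \<and>
    (\<forall>I\<in>set \<tau>. lo < fst I \<and> fst I < hi \<and> fst I \<noteq> t) \<and>
    (\<forall>e\<in>run A \<sigma> \<tau>. fst (fst e) < t \<longleftrightarrow> snd e \<notin> C)"
  using assms
proof (induction N arbitrary: \<sigma> lo hi)
  case 0
  then show ?case using dense[of lo hi] by auto
next
  case (Suc N)
  define p where "p = (lo + hi) / 2"
  have p: "lo < p" "p < hi" using Suc.prems by (auto simp: p_def)
  let ?I = "(p, p + 1)"
  show ?case
  proof (cases "A \<sigma> ?I \<in> C")
    case True
    obtain \<tau> t where "length \<tau> = N \<and> lo < t \<and> t < p \<and> unit_len \<tau> \<and>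
      (\<forall>I\<in>set \<tau>. lo < fst I \<and> fst I < p \<and> fst I \<noteq> t) \<and>
      (\<forall>e\<in>run A (\<sigma> @ [?I]) \<tau>. fst (fst e) < t \<longleftrightarrow> snd e \<notin> C)"
      using Suc.IH[OF p(1)] by blast
    then show ?thesis using p True by (intro exI[of _ "?I # \<tau>"] exI[of _ t]) force
  next
    case False
    obtain \<tau> t where "length \<tau> = N \<and> p < t \<and> t < hi \<and> unit_len \<tau> \<and>
      (\<forall>I\<in>set \<tau>. p < fst I \<and> fst I < hi \<and> fst I \<noteq> t) \<and>
      (\<forall>e\<in>run A (\<sigma> @ [?I]) \<tau>. fst (fst e) < t \<longleftrightarrow> snd e \<notin> C)"
      using Suc.IH[OF p(2)] by blast
    then show ?thesis using p False by (intro exI[of _ "?I # \<tau>"] exI[of _ t]) force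
  qed
qed

text \<open>The first \<open>n\<close> copies, the \<open>q\<close> intervals starting left of
  \<open>t\<close> and the \<open>2 * n - q\<close> final copies have pairwise disjoint color sets,
  and \<open>n + q + (2 * n - q) = 3 * n\<close>. Any unit history \<sigma> is allowed, so that
  gadgets can be played one after another.\<close>

lemma gadget:
  assumes alg: "online_coloring_algorithm A" and \<sigma>: "unit_len \<sigma>"
  shows "\<exists>\<tau>. unit_len \<tau> \<and> located \<tau> a (a + 3) \<and> (\<forall>x. load \<tau> x \<le> 2 * n) \<and>
    3 * n \<le> card (cols A \<sigma> \<tau>)"
proof -
  define L where "L = replicate n (a, a + 1)"
  define C where "C = cols A \<sigma> L"
  have cardC: "card C = n"
    unfolding C_def L_def
    by (rule card_cols_replicate[OF alg])
      (use \<sigma> in \<open>auto intro!: two_len_unit simp: is_interval_def\<close>)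
  \<comment> \<open>Left endpoints in this range put the new intervals to the right of
    \<open>(a, a + 1)\<close> and make them share the point \<open>a + 2\<close>, while
    \<open>(t - 1, t)\<close> still reaches \<open>(a, a + 1)\<close>.\<close>
  have half: "a + 3/2 < a + 2" by simp
  obtain R t where R: "length R = 2 * n" "a + 3/2 < t" "t < a + 2" "unit_len R"
    "\<And>I. I \<in> set R \<Longrightarrow> a + 3/2 < fst I \<and> fst I < a + 2 \<and> fst I \<noteq> t"
    "\<And>e. e \<in> run A (\<sigma> @ L) R \<Longrightarrow> fst (fst e) < t \<longleftrightarrow> snd e \<notin> C"
    using separation[where lo = "a + 3/2" and hi = "a + 2" and N = "2 * n" and C = C
        and A = A and \<sigma> = "\<sigma> @ L", OF half] by blast
  define R1 where "R1 = {e \<in> run A (\<sigma> @ L) R. fst (fst e) < t}"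
  define R2 where "R2 = {e \<in> run A (\<sigma> @ L) R. \<not> fst (fst e) < t}"
  define q where "q = length (filter (\<lambda>I. fst I < t) R)"
  have tl: "two_len ((\<sigma> @ L) @ R)"
    using \<sigma> R(4) by (intro two_len_unit) (auto simp: L_def)
  have pt: "a + 2 \<in> ival_set I" if "I \<in> set R" for I
    using R(4) R(5)[OF that] that by auto
  have cR1: "card (snd ` R1) = q" and
    cR2: "card (snd ` R2) = length (filter (\<lambda>I. \<not> fst I < t) R)"
    unfolding R1_def R2_def q_def by (rule card_cols_clique[OF alg tl pt]; assumption)+
  \<comment> \<open>The intervals of \<open>R\<close> on the right use distinct colors from
    \<open>C\<close>, which has only \<open>n\<close>; hence at least \<open>n\<close> of the
    \<open>2 * n\<close> intervals are on the left.\<close>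
  have "snd ` R2 \<subseteq> C" using R(6) by (auto simp: R2_def)
  then have "card (snd ` R2) \<le> n" using cardC card_mono[of C] by (simp add: C_def)
  moreover have "q + card (snd ` R2) = 2 * n"
    unfolding cR2 q_def R(1)[symmetric] by (rule sum_length_filter_compl)
  ultimately have q: "n \<le> q" "q \<le> 2 * n" by auto
  \<comment> \<open>An interval ending at \<open>t\<close> meets exactly those intervals of
    \<open>R\<close> that start before \<open>t\<close>.\<close>
  define F where "F = replicate (2 * n - q) (t - 1, t)"
  have tlF: "two_len ((\<sigma> @ L @ R) @ replicate (2 * n - q) (t - 1, t))"
    using \<sigma> R(4) by (intro two_len_unit) (auto simp: L_def)
  have cF: "card (cols A (\<sigma> @ L @ R) F) = 2 * n - q"
    unfolding F_def by (rule card_cols_replicate[OF alg tlF]) (simp add: is_interval_def)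
  have "snd ` (run A \<sigma> L \<union> R1) \<inter> cols A (\<sigma> @ L @ R) F = {}"
    unfolding F_def
  proof (rule cols_replicate_disjoint[OF alg tlF])
    show "run A \<sigma> L \<union> R1 \<subseteq> run A [] (\<sigma> @ L @ R)" by (auto simp: R1_def)
    fix J assume "J \<in> fst ` (run A \<sigma> L \<union> R1)"
    then have "J = (a, a + 1) \<or> J \<in> set R \<and> fst J < t"
      by (auto simp: R1_def L_def dest: in_run)
    then show "intersecting J (t - 1, t)"
    proof
      assume "J = (a, a + 1)"
      then show ?thesis using R(2,3) by (simp add: intersecting_iff is_interval_def)
    next
      assume "J \<in> set R \<and> fst J < t"
      then show ?thesis using R(2,3,4) R(5)[of J] by (simp add: intersecting_iff is_interval_def)
    qed
  qed
  then have d1: "(C \<union> snd ` R1) \<inter> cols A (\<sigma> @ L @ R) F = {}" by (simp add: C_def image_Un)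
  have d2: "C \<inter> snd ` R1 = {}" using R(6) by (auto simp: R1_def)
  let ?\<tau> = "L @ R @ F"
  have fin: "finite C" "finite (snd ` R1)" by (auto simp: C_def R1_def)
  have "card ((C \<union> snd ` R1) \<union> cols A (\<sigma> @ L @ R) F) = card (C \<union> snd ` R1) + (2 * n - q)"
    using d1 fin cF by (subst card_Un_disjoint) auto
  also have "card (C \<union> snd ` R1) = n + q"
    using d2 fin cardC cR1 by (subst card_Un_disjoint) auto
  finally have "card ((C \<union> snd ` R1) \<union> cols A (\<sigma> @ L @ R) F) = 3 * n" using q by simp
  moreover have "(C \<union> snd ` R1) \<union> cols A (\<sigma> @ L @ R) F \<subseteq> cols A \<sigma> ?\<tau>"
    by (auto simp: C_def R1_def)
  ultimately have "3 * n \<le> card (cols A \<sigma> ?\<tau>)"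
    by (metis card_mono finite_imageI finite_run)
  moreover have "unit_len ?\<tau>" using R(4) by (auto simp: L_def F_def)
  moreover have "located ?\<tau> a (a + 3)" using R(2,3,4) R(5) by (force simp: L_def F_def)
  \<comment> \<open>Up to \<open>a + 3/2\<close> only \<open>L\<close> and \<open>F\<close> count,
    at most \<open>n + (2 * n - q)\<close>; from there to \<open>t\<close> only \<open>F\<close> and
    at most \<open>q\<close> intervals of \<open>R\<close>; beyond \<open>t\<close> only
    \<open>R\<close>.\<close>
  moreover have "load ?\<tau> x \<le> 2 * n" for x
  proof -
    have "load R x \<le> 2 * n" using R(1) by (metis length_filter_le load_def)
    moreover have "load R x = 0" if "x \<le> a + 3/2"
      using that R(5) by (intro load_eq_0) force
    moreover have "load R x \<le> q" if "x \<le> t"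
      unfolding q_def using that R(5) by (intro load_le_filter) force
    ultimately show ?thesis using q R(2,3) by (auto simp: L_def F_def)
  qed
  ultimately show ?thesis by blast
qed

section \<open>Clusters of unit gadgets and long intervals\<close>

text \<open>The load bound \<open>m\<close> also bounds the chromatic number, by
  \<open>chromatic_number_graph_of\<close>.\<close>

definition forces :: "algorithm \<Rightarrow> nat \<Rightarrow> nat \<Rightarrow> bool" where
  "forces A m k \<longleftrightarrow> (\<exists>\<sigma>. two_len \<sigma> \<and> (\<forall>x. load \<sigma> x \<le> m) \<and> k \<le> num_colors A \<sigma>)"

text \<open>In units of \<open>W\<close> and relative to \<open>a\<close>, the two disjoint groups are at \<open>[0, 10]\<close> and \<open>[18, 28]\<close>,
  the group meeting both is at \<open>[9, 19]\<close>, and the two groups of the path are at \<open>[12, 22]\<close> and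
  \<open>[6, 16]\<close>. The four clusters lie outside all pairwise intersections of groups played together.\<close>

lemma long_intervals:
  fixes W a :: real
  assumes alg: "online_coloring_algorithm A" and W: "W > 0"
    and units: "unit_len \<sigma>" "unit_len \<tau>1" "unit_len \<tau>2" "unit_len \<tau>3" "unit_len \<tau>4"
    and located: "\<forall>I\<in>set \<sigma>. snd I < a"
      "located \<tau>1 (a + 1 * W) (a + 2 * W)" "located \<tau>2 (a + 21/2 * W) (a + 23/2 * W)"
      "located \<tau>3 (a + 33/2 * W) (a + 35/2 * W)" "located \<tau>4 (a + 23 * W) (a + 24 * W)"
    and loads: "\<forall>x. load \<sigma> x \<le> 2 * n" "\<forall>x. load \<tau>1 x \<le> 2 * n" "\<forall>x. load \<tau>2 x \<le> 2 * n"
      "\<forall>x. load \<tau>3 x \<le> 2 * n" "\<forall>x. load \<tau>4 x \<le> 2 * n"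
    and C: "cols A \<sigma> \<tau>1 = C" "cols A (\<sigma> @ \<tau>1) \<tau>2 = C" "cols A (\<sigma> @ \<tau>1 @ \<tau>2) \<tau>3 = C"
      "cols A (\<sigma> @ \<tau>1 @ \<tau>2 @ \<tau>3) \<tau>4 = C"
    and cardC: "3 * n \<le> card C"
  shows "forces A (4 * n) (8 * n)"
proof -
  define \<beta> where "\<beta> = \<sigma> @ \<tau>1 @ \<tau>2 @ \<tau>3 @ \<tau>4"
  define J where "J z = (a + z * W, a + z * W + 10 * W)" for z
  define \<rho> where "\<rho> zs = concat (map (\<lambda>z. replicate (2 * n) (J z)) zs)" for zs
  \<comment> \<open>The colors of the group at \<open>z\<close> depend on the groups played before
    it, so these are recorded in \<open>zs\<close>.\<close>
  define D where "D zs z = cols A (\<beta> @ \<rho> zs) (replicate (2 * n) (J z))" for zs z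
  have \<rho>_snoc: "\<rho> (zs @ [z]) = \<rho> zs @ replicate (2 * n) (J z)" for zs z
    by (simp add: \<rho>_def)
  have set_\<rho>: "set (\<rho> zs) \<subseteq> J ` set zs" for zs by (auto simp: \<rho>_def)
  have iJ: "is_interval (J z)" for z using W by (simp add: J_def is_interval_def)
  have tl: "two_len (\<beta> @ \<rho> zs)" for zs
    using W units set_\<rho>[of zs]
    by (intro two_lenI[of "10 * W"]) (auto simp: \<beta>_def ival_length_def J_def)
  have tl': "two_len ((\<beta> @ \<rho> zs) @ replicate (2 * n) (J z))" for zs z
    using tl[of "zs @ [z]"] by (simp add: \<rho>_snoc)
  have cardD: "card (D zs z) = 2 * n" for zs z
    unfolding D_def by (rule card_cols_replicate[OF alg tl' iJ])
  have finD [simp]: "finite (D zs z)" for zs z by (simp add: D_def)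
  have finC [simp]: "finite C" unfolding C(1)[symmetric] by simp
  have JJ: "intersecting (J y) (J z) \<longleftrightarrow> \<bar>y - z\<bar> \<le> 10" for y z
  proof -
    have "intersecting (J y) (J z) \<longleftrightarrow> y * W \<le> (z + 10) * W \<and> z * W \<le> (y + 10) * W"
      by (subst intersecting_iff[OF iJ iJ]) (simp add: J_def algebra_simps)
    then show ?thesis using W by (auto simp: abs_le_iff)
  qed
  have DD: "D ys y \<inter> D (ys @ y # xs) z = {}" if "\<bar>y - z\<bar> \<le> 10" for xs ys y z
    unfolding D_def
  proof (rule cols_replicate_disjoint[OF alg tl'])
    show "run A (\<beta> @ \<rho> ys) (replicate (2 * n) (J y)) \<subseteq> run A [] (\<beta> @ \<rho> (ys @ y # xs))"
      by (auto simp: \<rho>_def)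
    fix K assume "K \<in> fst ` run A (\<beta> @ \<rho> ys) (replicate (2 * n) (J y))"
    then have "K = J y" by (auto simp: fst_run)
    then show "intersecting K (J z)" using that JJ by simp
  qed
  have avoid: "C \<inter> D zs z = {}"
    if "cols A \<kappa> \<tau> = C" "run A \<kappa> \<tau> \<subseteq> run A [] \<beta>" "unit_len \<tau>"
      "located \<tau> (a + x * W) (a + y * W)" "z \<le> x" "y \<le> z + 10" for \<kappa> \<tau> x y zs z
    unfolding that(1)[symmetric] D_def
  proof (rule cols_replicate_disjoint[OF alg tl'])
    show "run A \<kappa> \<tau> \<subseteq> run A [] (\<beta> @ \<rho> zs)" using that(2) by auto
    fix K assume "K \<in> fst ` run A \<kappa> \<tau>"
    then have K: "K \<in> set \<tau>" by (simp add: fst_run)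
    have "z * W \<le> x * W" "y * W \<le> (z + 10) * W" using that(5,6) W by simp_all
    then show "intersecting K (J z)"
      using K that(3,4) iJ[of z] by (subst intersecting_iff) (force simp: J_def is_interval_def algebra_simps)+
  qed
  have sub: "run A \<sigma> \<tau>1 \<subseteq> run A [] \<beta>" "run A (\<sigma> @ \<tau>1) \<tau>2 \<subseteq> run A [] \<beta>"
    "run A (\<sigma> @ \<tau>1 @ \<tau>2) \<tau>3 \<subseteq> run A [] \<beta>" "run A (\<sigma> @ \<tau>1 @ \<tau>2 @ \<tau>3) \<tau>4 \<subseteq> run A [] \<beta>"
    by (auto simp: \<beta>_def)
  \<comment> \<open>The first cluster lies inside the group at 0, the second inside those at 6 and
    9, the third inside those at 9 and 12, the fourth inside the one at 18.\<close>
  have CD: "C \<inter> D zs z = {}" if "z \<in> {0, 6, 9, 12, 18}" for zs z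
    using that avoid[OF C(1) sub(1) units(2) located(2), of z zs]
      avoid[OF C(2) sub(2) units(3) located(3), of z zs]
      avoid[OF C(3) sub(3) units(4) located(4), of z zs]
      avoid[OF C(4) sub(4) units(5) located(5), of z zs]
    by auto
  have load_\<beta>: "load \<beta> (a + y * W) \<le>
      (if y < 0 \<or> y \<in> {1..2} \<union> {21/2..23/2} \<union> {33/2..35/2} \<union> {23..24} then 2 * n else 0)" for y
  proof -
    have part: "load \<tau> (a + y * W) \<le> (if u \<le> y \<and> y \<le> v then 2 * n else 0)"
      if "located \<tau> (a + u * W) (a + v * W)" "\<forall>x. load \<tau> x \<le> 2 * n" for \<tau> u v
      using that(2) load_located[OF that(1), of "a + y * W"] W by auto
    have "load \<sigma> (a + y * W) = 0" if "y \<ge> 0"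
    proof (rule load_eq_0)
      fix I assume "I \<in> set \<sigma>"
      moreover have "y * W \<ge> 0" using that W by simp
      ultimately show "a + y * W \<notin> ival_set I" using located(1) by force
    qed
    then have "load \<sigma> (a + y * W) \<le> (if y < 0 then 2 * n else 0)" using loads(1) by simp
    note parts = this part[OF located(2) loads(2)] part[OF located(3) loads(3)]
      part[OF located(4) loads(4)] part[OF located(5) loads(5)]
    consider "y < 0" | "0 \<le> y" "y \<le> 2" | "2 < y" "y \<le> 23/2" | "23/2 < y" "y \<le> 35/2" | "35/2 < y"
      by linarith
    then show ?thesis
      unfolding \<beta>_def load_append by cases (use parts in \<open>auto split: if_splits\<close>)
  qed
  have in_J: "fst (J z) \<le> a + y * W \<longleftrightarrow> z \<le> y" "a + y * W \<le> snd (J z) \<longleftrightarrow> y \<le> z + 10" for y z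
  proof -
    have "a + y * W \<le> snd (J z) \<longleftrightarrow> y * W \<le> (z + 10) * W"
      by (simp add: J_def algebra_simps)
    then show "a + y * W \<le> snd (J z) \<longleftrightarrow> y \<le> z + 10" using W by simp
  qed (use W in \<open>simp add: J_def\<close>)
  have ex_y: "\<exists>y. x = a + y * W" for x
    using W by (intro exI[of _ "(x - a) / W"]) simp
  have num: "cols A [] (\<beta> @ \<rho> zs) \<supseteq> C" for zs
    using sub(1) C(1) by auto
  have numD: "D ys z \<subseteq> cols A [] (\<beta> @ \<rho> (ys @ z # xs))" for ys xs z
    by (auto simp: D_def \<rho>_def)
  have card_Un3: "card (X \<union> (Y \<union> Z)) = card X + (card Y + card Z)"
    if "finite X" "finite Y" "finite Z" "X \<inter> Y = {}" "X \<inter> Z = {}" "Y \<inter> Z = {}" for X Y Z :: "nat set"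
    using that by (simp add: card_Un_disjoint Int_Un_distrib)
  have C_PQ: "C \<inter> D [] 0 = {}" "C \<inter> D [0] 18 = {}" using CD by simp_all
  let ?P = "D [] 0" and ?Q = "D [0] 18"
  have PQ: "card (?P \<union> ?Q) + card (?P \<inter> ?Q) = 4 * n"
    using card_Un_Int[of ?P ?Q] cardD by simp
  show ?thesis
  proof (cases "card (?P \<inter> ?Q) \<le> n")
    case True
    \<comment> \<open>The union of \<open>?P\<close> and \<open>?Q\<close> has at least
      \<open>3 * n\<close> colors, and \<open>?M\<close> avoids both sets; together with
      \<open>C\<close> this gives \<open>3 * n + 3 * n + 2 * n\<close>.\<close>
    let ?M = "D [0, 18] 9"
    have "?P \<inter> ?M = {}" "?Q \<inter> ?M = {}"
      using DD[of 0 9 "[]" "[18]"] DD[of 18 9 "[0]" "[]"] by simp_all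
    moreover have "C \<inter> ?M = {}" using CD by simp
    ultimately have "card (C \<union> ((?P \<union> ?Q) \<union> ?M)) = card C + (card (?P \<union> ?Q) + 2 * n)"
      using C_PQ by (subst card_Un3) (simp_all add: cardD Int_Un_distrib Int_Un_distrib2)
    moreover have "C \<union> ((?P \<union> ?Q) \<union> ?M) \<subseteq> cols A [] (\<beta> @ \<rho> [0, 18, 9])"
      using num numD[of "[]" 0 "[18, 9]"] numD[of "[0]" 18 "[9]"] numD[of "[0, 18]" 9 "[]"]
      unfolding append.simps by blast
    ultimately have "8 * n \<le> num_colors A (\<beta> @ \<rho> [0, 18, 9])"
      using card_mono[of "cols A [] (\<beta> @ \<rho> [0, 18, 9])" "C \<union> ((?P \<union> ?Q) \<union> ?M)"] PQ True cardC
      unfolding num_colors_conv_cols by simp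
    \<comment> \<open>No point lies in three groups, and a point in one of the four clusters lies in
      at most one group; each group or cluster contributes at most \<open>2 * n\<close>.\<close>
    moreover have "load (\<beta> @ \<rho> [0, 18, 9]) x \<le> 4 * n" for x
    proof -
      obtain y where x: "x = a + y * W" using ex_y by blast
      show ?thesis using load_\<beta>[of y] unfolding x by (auto simp: \<rho>_def in_J split: if_splits)
    qed
    ultimately show ?thesis using tl unfolding forces_def by blast
  next
    case False
    \<comment> \<open>\<open>?F\<close> avoids \<open>?Q\<close>, while \<open>?H\<close> avoids
      \<open>?P\<close> and \<open>?F\<close>. So the more than \<open>n\<close> common colors of
      \<open>?P\<close> and \<open>?Q\<close> are disjoint from both new sets, which are disjoint
      from each other: more than \<open>5 * n\<close> long colors.\<close>
    let ?F = "D [0, 18] 12" and ?H = "D [0, 18, 12] 6"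
    have d: "?Q \<inter> ?F = {}" "?P \<inter> ?H = {}" "?F \<inter> ?H = {}"
      using DD[of 18 12 "[0]" "[]"] DD[of 0 6 "[]" "[18, 12]"] DD[of 12 6 "[0, 18]" "[]"]
      by simp_all
    moreover have "C \<inter> ?F = {}" "C \<inter> ?H = {}" using CD by simp_all
    moreover have "card ((?P \<inter> ?Q) \<union> ?F) = card (?P \<inter> ?Q) + 2 * n"
      using d by (subst card_Un_disjoint) (auto simp: cardD)
    moreover have "((?P \<inter> ?Q) \<union> ?F) \<inter> ?H = {}" "C \<inter> ((?P \<inter> ?Q) \<union> ?F) = {}"
      using d C_PQ calculation by blast+
    ultimately have "card (C \<union> (((?P \<inter> ?Q) \<union> ?F) \<union> ?H)) = card C + ((card (?P \<inter> ?Q) + 2 * n) + 2 * n)"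
      by (subst card_Un3) (simp_all add: cardD)
    moreover have "C \<union> (((?P \<inter> ?Q) \<union> ?F) \<union> ?H) \<subseteq> cols A [] (\<beta> @ \<rho> [0, 18, 12, 6])"
      using num numD[of "[]" 0 "[18, 12, 6]"] numD[of "[0, 18]" 12 "[6]"] numD[of "[0, 18, 12]" 6 "[]"]
      unfolding append.simps by blast
    ultimately have "8 * n \<le> num_colors A (\<beta> @ \<rho> [0, 18, 12, 6])"
      using card_mono[of "cols A [] (\<beta> @ \<rho> [0, 18, 12, 6])" "C \<union> (((?P \<inter> ?Q) \<union> ?F) \<union> ?H)"] False cardC
      unfolding num_colors_conv_cols by simp
    moreover have "load (\<beta> @ \<rho> [0, 18, 12, 6]) x \<le> 4 * n" for x
    proof -
      obtain y where x: "x = a + y * W" using ex_y by blast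
      show ?thesis using load_\<beta>[of y] unfolding x by (auto simp: \<rho>_def in_J split: if_splits)
    qed
    ultimately show ?thesis using tl unfolding forces_def by blast
  qed
qed

section \<open>Nesting the clusters\<close>

lemma load_append_located:
  assumes "\<forall>x. load \<sigma> x \<le> m" "\<forall>x. load \<tau> x \<le> m" "\<forall>I\<in>set \<sigma>. snd I < a" "located \<tau> a b"
  shows "\<forall>x. load (\<sigma> @ \<tau>) x \<le> m"
proof
  fix x
  have "load \<sigma> x = 0 \<or> load \<tau> x = 0"
  proof (cases "x < a")
    case True
    then show ?thesis using load_located[OF assms(4), of x] by simp
  next
    case False
    have "load \<sigma> x = 0"
    proof (rule load_eq_0)
      fix I assume "I \<in> set \<sigma>"
      then have "snd I < a" using assms(3) by blast
      then show "x \<notin> ival_set I" using False by simp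
    qed
    then show ?thesis ..
  qed
  then show "load (\<sigma> @ \<tau>) x \<le> m" using assms(1,2) by auto
qed

text \<open>\<open>d\<close> is the nesting level, and each level gains one color. \<open>W\<close>
  is chosen before \<sigma> and \<open>a\<close>: the four parts have different histories but must
  share one scale for the long intervals.\<close>

lemma cluster:
  assumes alg: "online_coloring_algorithm A" and nf: "\<not> forces A (4 * n) (8 * n)"
  shows "\<exists>W>0. \<forall>\<sigma> a. unit_len \<sigma> \<longrightarrow> (\<forall>x. load \<sigma> x \<le> 2 * n) \<longrightarrow> (\<forall>I\<in>set \<sigma>. snd I < a) \<longrightarrow>
    (\<exists>\<tau>. unit_len \<tau> \<and> located \<tau> a (a + W) \<and> (\<forall>x. load \<tau> x \<le> 2 * n) \<and>
      3 * n + d \<le> card (cols A \<sigma> \<tau>))"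
proof (induction d)
  case 0
  then show ?case using gadget[OF alg] by (intro exI[of _ 3]) simp
next
  case (Suc d)
  then obtain W where W: "W > 0" and IH: "\<And>\<sigma> a. unit_len \<sigma> \<Longrightarrow> \<forall>x. load \<sigma> x \<le> 2 * n \<Longrightarrow>
      \<forall>I\<in>set \<sigma>. snd I < a \<Longrightarrow> \<exists>\<tau>. unit_len \<tau> \<and> located \<tau> a (a + W) \<and>
        (\<forall>x. load \<tau> x \<le> 2 * n) \<and> 3 * n + d \<le> card (cols A \<sigma> \<tau>)"
    by blast
  show ?case
  \<comment> \<open>The four parts occupy the positions required by \<open>long_intervals\<close>,
    the last one ending at \<open>a + 24 * W\<close>.\<close>
  proof (intro exI[of _ "24 * W"] conjI allI impI)
    show "24 * W > 0" using W by simp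
    fix \<sigma> a assume \<sigma>: "unit_len \<sigma>" "\<forall>x. load \<sigma> x \<le> 2 * n" "\<forall>I\<in>set \<sigma>. snd I < a"
    \<comment> \<open>One use of the induction hypothesis to the right of everything played so far.
      The last three conjuncts restore the premises on \<kappa> for the next part.\<close>
    have part: "\<exists>\<tau>. unit_len \<tau> \<and> located \<tau> (a + u * W) (a + v * W) \<and> (\<forall>x. load \<tau> x \<le> 2 * n) \<and>
        3 * n + d \<le> card (cols A \<kappa> \<tau>) \<and> unit_len (\<kappa> @ \<tau>) \<and> (\<forall>x. load (\<kappa> @ \<tau>) x \<le> 2 * n) \<and>
        (\<forall>I\<in>set (\<kappa> @ \<tau>). snd I \<le> a + v * W)"
      if \<kappa>: "unit_len \<kappa>" "\<forall>x. load \<kappa> x \<le> 2 * n" "\<forall>I\<in>set \<kappa>. snd I \<le> a + w * W"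
        and uv: "w < u" "v = u + 1" for \<kappa> u v w
    proof -
      have lt: "\<forall>I\<in>set \<kappa>. snd I < a + u * W" using \<kappa>(3) uv(1) W
        by (smt (verit) mult_strict_right_mono)
      have v: "a + v * W = a + u * W + W" using uv(2) by (simp add: algebra_simps)
      obtain \<tau> where \<tau>: "unit_len \<tau>" "located \<tau> (a + u * W) (a + v * W)" "\<forall>x. load \<tau> x \<le> 2 * n"
        "3 * n + d \<le> card (cols A \<kappa> \<tau>)"
        using IH[OF \<kappa>(1,2) lt] unfolding v by blast
      have "\<forall>x. load (\<kappa> @ \<tau>) x \<le> 2 * n"
        by (rule load_append_located[OF \<kappa>(2) \<tau>(3) lt \<tau>(2)])
      moreover have "\<forall>I\<in>set (\<kappa> @ \<tau>). snd I \<le> a + v * W"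
        using lt \<tau>(2) v W by force
      ultimately show ?thesis using \<kappa>(1) \<tau> by (intro exI[of _ \<tau>]) auto
    qed
    have step1: "(0::real) < 1" "(2::real) = 1 + 1"
      and step2: "(2::real) < 21/2" "(23/2::real) = 21/2 + 1"
      and step3: "(23/2::real) < 33/2" "(35/2::real) = 33/2 + 1"
      and step4: "(35/2::real) < 23" "(24::real) = 23 + 1"
      by simp_all
    have \<sigma>0: "\<forall>I\<in>set \<sigma>. snd I \<le> a + 0 * W" using \<sigma>(3) by force
    obtain \<tau>1 where t1: "unit_len \<tau>1" "located \<tau>1 (a + 1 * W) (a + 2 * W)" "\<forall>x. load \<tau>1 x \<le> 2 * n"
      "3 * n + d \<le> card (cols A \<sigma> \<tau>1)" "unit_len (\<sigma> @ \<tau>1)" "\<forall>x. load (\<sigma> @ \<tau>1) x \<le> 2 * n"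
      "\<forall>I\<in>set (\<sigma> @ \<tau>1). snd I \<le> a + 2 * W"
      using part[OF \<sigma>(1,2) \<sigma>0, OF step1] by blast
    obtain \<tau>2 where t2: "unit_len \<tau>2" "located \<tau>2 (a + 21/2 * W) (a + 23/2 * W)"
      "\<forall>x. load \<tau>2 x \<le> 2 * n" "3 * n + d \<le> card (cols A (\<sigma> @ \<tau>1) \<tau>2)"
      "unit_len ((\<sigma> @ \<tau>1) @ \<tau>2)" "\<forall>x. load ((\<sigma> @ \<tau>1) @ \<tau>2) x \<le> 2 * n"
      "\<forall>I\<in>set ((\<sigma> @ \<tau>1) @ \<tau>2). snd I \<le> a + 23/2 * W"
      using part[OF t1(5-7), OF step2] by blast
    obtain \<tau>3 where t3: "unit_len \<tau>3" "located \<tau>3 (a + 33/2 * W) (a + 35/2 * W)"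
      "\<forall>x. load \<tau>3 x \<le> 2 * n" "3 * n + d \<le> card (cols A ((\<sigma> @ \<tau>1) @ \<tau>2) \<tau>3)"
      "unit_len (((\<sigma> @ \<tau>1) @ \<tau>2) @ \<tau>3)" "\<forall>x. load (((\<sigma> @ \<tau>1) @ \<tau>2) @ \<tau>3) x \<le> 2 * n"
      "\<forall>I\<in>set (((\<sigma> @ \<tau>1) @ \<tau>2) @ \<tau>3). snd I \<le> a + 35/2 * W"
      using part[OF t2(5-7), OF step3] by blast
    obtain \<tau>4 where t4: "unit_len \<tau>4" "located \<tau>4 (a + 23 * W) (a + 24 * W)"
      "\<forall>x. load \<tau>4 x \<le> 2 * n" "3 * n + d \<le> card (cols A (((\<sigma> @ \<tau>1) @ \<tau>2) @ \<tau>3) \<tau>4)"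
      using part[OF t3(5-7), OF step4] by blast
    let ?\<tau> = "\<tau>1 @ \<tau>2 @ \<tau>3 @ \<tau>4"
    let ?C = "cols A \<sigma> ?\<tau>"
    let ?C1 = "cols A \<sigma> \<tau>1" and ?C2 = "cols A (\<sigma> @ \<tau>1) \<tau>2"
      and ?C3 = "cols A (\<sigma> @ \<tau>1 @ \<tau>2) \<tau>3" and ?C4 = "cols A (\<sigma> @ \<tau>1 @ \<tau>2 @ \<tau>3) \<tau>4"
    have sub: "?C1 \<subseteq> ?C" "?C2 \<subseteq> ?C" "?C3 \<subseteq> ?C" "?C4 \<subseteq> ?C"
      by auto
    \<comment> \<open>If every part shows all colors of the cluster, long intervals of length
      \<open>10 * W\<close> succeed, contrary to \<open>nf\<close>.\<close>
    have "\<not> (?C1 = ?C \<and> ?C2 = ?C \<and> ?C3 = ?C \<and> ?C4 = ?C)"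
    proof (rule notI, elim conjE)
      assume eqs: "?C1 = ?C" "?C2 = ?C" "?C3 = ?C" "?C4 = ?C"
      then have "3 * n \<le> card ?C" using t1(4) unfolding eqs(1) by linarith
      then have "forces A (4 * n) (8 * n)"
        by (rule long_intervals[OF alg W \<sigma>(1) t1(1) t2(1) t3(1) t4(1) \<sigma>(3) t1(2) t2(2)
              t3(2) t4(2) \<sigma>(2) t1(3) t2(3) t3(3) t4(3) eqs])
      then show False using nf by blast
    qed
    \<comment> \<open>Some part misses a color of the cluster, so the cluster exceeds the
      \<open>3 * n + d\<close> colors of that part.\<close>
    then have "card ?C1 < card ?C \<or> card ?C2 < card ?C \<or> card ?C3 < card ?C \<or> card ?C4 < card ?C"
      using sub by (metis finite_imageI finite_run psubsetI psubset_card_mono)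
    then have "3 * n + Suc d \<le> card ?C"
      using t1(4) t2(4) t3(4) t4(4) unfolding append_assoc by linarith
    moreover have "unit_len ?\<tau>" using t1(1) t2(1) t3(1) t4(1) by auto
    moreover have "located ?\<tau> a (a + 24 * W)"
      using t1(2) t2(2) t3(2) t4(2) W by force
    moreover have "\<forall>x. load ?\<tau> x \<le> 2 * n"
    proof -
      have "\<forall>x. load ((((\<sigma> @ \<tau>1) @ \<tau>2) @ \<tau>3) @ \<tau>4) x \<le> 2 * n"
        by (rule load_append_located[OF t3(6) t4(3) _ t4(2)]) (use t3(7) W in force)
      then show ?thesis by (simp add: add.assoc) (meson add_leD2)
    qed
    ultimately show "\<exists>\<tau>. unit_len \<tau> \<and> located \<tau> a (a + 24 * W) \<and> (\<forall>x. load \<tau> x \<le> 2 * n) \<and>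
        3 * n + Suc d \<le> card (cols A \<sigma> \<tau>)"
      by blast
  qed
qed

text \<open>If long intervals never succeed, \<open>5 * n\<close> levels of nesting raise the
  \<open>3 * n\<close> colors of a gadget to \<open>8 * n\<close> with unit intervals alone.\<close>

lemma online_algorithm_forces:
  assumes alg: "online_coloring_algorithm A"
  shows "forces A (4 * n) (8 * n)"
proof (rule ccontr)
  assume nf: "\<not> ?thesis"
  obtain W where "\<forall>\<sigma> a. unit_len \<sigma> \<longrightarrow> (\<forall>x. load \<sigma> x \<le> 2 * n) \<longrightarrow> (\<forall>I\<in>set \<sigma>. snd I < a) \<longrightarrow>
    (\<exists>\<tau>. unit_len \<tau> \<and> located \<tau> a (a + W) \<and> (\<forall>x. load \<tau> x \<le> 2 * n) \<and>
      3 * n + 5 * n \<le> card (cols A \<sigma> \<tau>))"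
    using cluster[OF alg nf, of "5 * n"] by blast
  from this[rule_format, of "[]" 0] obtain \<tau> where \<tau>: "unit_len \<tau>" "\<And>x. load \<tau> x \<le> 2 * n"
    "8 * n \<le> card (cols A [] \<tau>)"
    by auto
  have "load \<tau> x \<le> 4 * n" for x using \<tau>(2)[of x] by simp
  then have "forces A (4 * n) (8 * n)"
    using \<tau>(1,3) two_len_unit unfolding forces_def num_colors_conv_cols by blast
  then show False using nf by blast
qed

section \<open>Passing to the competitive ratio\<close>

lemma competitive_ge_2:
  assumes alg: "online_coloring_algorithm A" and "competitive A \<rho>"
  shows "\<rho> \<ge> 2"
proof (rule ccontr)
  assume less: "\<not> \<rho> \<ge> 2"
  obtain b where b: "\<And>G. two_count_graph G \<Longrightarrow>
      real (online_chromatic A G) \<le> \<rho> * real (chromatic_number G) + b"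
    using assms(2) unfolding competitive_def by blast
  \<comment> \<open>A negative factor would reverse the upper bound on the chromatic number, hence
    the truncation at 0.\<close>
  define r where "r = max \<rho> 0"
  have r: "0 \<le> r" "r < 2" "\<rho> \<le> r" using less by (auto simp: r_def)
  \<comment> \<open>This choice makes \<open>8 * n\<close> exceed \<open>r * (4 * n) + b\<close>, so
    the additive constant cannot help.\<close>
  obtain n :: nat where n: "b / (8 - 4 * r) < real n" using reals_Archimedean2 by blast
  obtain \<sigma> where \<sigma>: "two_len \<sigma>" "\<And>x. load \<sigma> x \<le> 4 * n" "8 * n \<le> num_colors A \<sigma>"
    using online_algorithm_forces[OF alg, of n] unfolding forces_def by blast
  let ?G = "graph_of \<sigma>"
  have "num_colors A \<sigma> \<le> online_chromatic A ?G"
    unfolding online_chromatic_def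
    using presents_graph_of[OF \<sigma>(1)] by (intro Max_ge online_chromatic_finite) blast
  then have "8 * real n \<le> real (online_chromatic A ?G)" using \<sigma>(3) by linarith
  also have "\<dots> \<le> \<rho> * real (chromatic_number ?G) + b"
    by (rule b[OF two_count_graph_of[OF \<sigma>(1)]])
  also have "\<rho> * real (chromatic_number ?G) \<le> r * real (chromatic_number ?G)"
    using r(3) by (intro mult_right_mono) auto
  also have "r * real (chromatic_number ?G) \<le> r * (4 * real n)"
    using chromatic_number_graph_of[OF \<sigma>(1,2)] r(1) by (intro mult_left_mono) auto
  finally have "real n * (8 - 4 * r) \<le> b" by (simp add: algebra_simps)
  then show False using n r(2) by (simp add: divide_less_eq)
qed

theorem theorem21:
  shows "two_plus \<ge> 2 \<and>
    \<not> (\<exists>A. online_coloring_algorithm A \<and> competitive_ratio A < 2)"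
proof -
  have ratio: "2 \<le> competitive_ratio A" if alg: "online_coloring_algorithm A" for A
    unfolding competitive_ratio_def
  proof (rule Inf_greatest)
    fix x assume "x \<in> {ereal \<rho> |\<rho>. competitive A \<rho>}"
    then obtain \<rho> where "x = ereal \<rho>" "\<rho> \<ge> 2" using competitive_ge_2[OF alg] by blast
    then show "2 \<le> x" by simp
  qed
  then have "2 \<le> two_plus" unfolding two_plus_def by (auto intro: Inf_greatest)
  then show ?thesis using ratio by (auto simp: not_less)
qed

end
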